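(* For every $n$, $$|\mathcal{DP}_n| = 3\cdot 2^{n+1}-(n+2)^2-1.$$
   Context: For $n\ge 0$ let $X_n=\{1,2,\dots,n\}$ and let $\mathcal{I}_n$ be the set of all partial injective maps of $X_n$ (including the empty map). $\mathcal{DP}_n$ is the set of all $\alpha\in\mathcal{I}_n$ with $|x-y|=|x\alpha-y\alpha|$ for all $x,y\in\mathrm{Dom}\,\alpha$ (partial isometries; $x\alpha$ denotes the image of $x$ under $\alpha$). *)

theory Defs
  imports Main
begin

definition X :: "nat \<Rightarrow> nat set" where
  "X n = {1..n}"

text \<open>A partial map of \<open>X n\<close> is a map \<open>nat \<rightharpoonup> nat\<close> whose domain and range lie in \<open>X n\<close>,
  so that distinct elements of \<open>I n\<close> are distinct partial maps of \<open>X n\<close>.\<close>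

definition I :: "nat \<Rightarrow> (nat \<rightharpoonup> nat) set" where
  "I n = {\<alpha>. dom \<alpha> \<subseteq> X n \<and> ran \<alpha> \<subseteq> X n \<and> inj_on \<alpha> (dom \<alpha>)}"

text \<open>Differences are taken in \<open>int\<close>, because subtraction on \<open>nat\<close> truncates.\<close>

definition DP :: "nat \<Rightarrow> (nat \<rightharpoonup> nat) set" where
  "DP n = {\<alpha> \<in> I n. \<forall>x \<in> dom \<alpha>. \<forall>y \<in> dom \<alpha>.
     \<bar>int x - int y\<bar> = \<bar>int (the (\<alpha> x)) - int (the (\<alpha> y))\<bar>}"

end

theory Submission
  imports Defs
begin

text \<open>A partial isometry of a subset of the line is the restriction of a translation or of a
  reflection, and it is both exactly when its rank is at most one. Composing with
  \<open>x \<mapsto> n + 1 - x\<close> exchanges the two kinds, so the count is twice the number of partial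
  translations minus \<open>1 + n\<^sup>2\<close>. A nonempty partial translation is a shift \<open>c\<close> together with a
  nonempty subset of the \<open>n - \<bar>c\<bar>\<close> points that \<open>c\<close> keeps inside \<open>X n\<close>.\<close>

section \<open>Partial isometries as restrictions of affine maps of slope 1 or -1\<close>

definition affine_maps :: "int \<Rightarrow> nat \<Rightarrow> (nat \<rightharpoonup> nat) set" where
  "affine_maps s n = {\<alpha>. dom \<alpha> \<subseteq> X n \<and> ran \<alpha> \<subseteq> X n \<and>
     (\<exists>c. \<forall>x y. \<alpha> x = Some y \<longrightarrow> int y = c + s * int x)}"

lemma finite_affine_maps: "finite (affine_maps s n)"
proof (rule finite_subset)
  show "affine_maps s n \<subseteq> (\<Union>A\<in>Pow (X n). {\<alpha>. dom \<alpha> = A \<and> ran \<alpha> \<subseteq> X n})"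
    by (auto simp: affine_maps_def)
  show "finite (\<Union>A\<in>Pow (X n). {\<alpha>. dom \<alpha> = A \<and> ran \<alpha> \<subseteq> X n})"
    by (intro finite_UN_I finite_set_of_finite_maps) (auto simp: X_def intro: finite_subset)
qed

lemma affine_maps_subset_DP:
  assumes "\<bar>s\<bar> = 1"
  shows "affine_maps s n \<subseteq> DP n"
proof
  fix \<alpha> assume "\<alpha> \<in> affine_maps s n"
  then obtain c where dr: "dom \<alpha> \<subseteq> X n" "ran \<alpha> \<subseteq> X n"
    and c: "\<And>x y. \<alpha> x = Some y \<Longrightarrow> int y = c + s * int x"
    by (auto simp: affine_maps_def)
  have iso: "\<bar>int x - int x'\<bar> = \<bar>int y - int y'\<bar>" if "\<alpha> x = Some y" "\<alpha> x' = Some y'" for x x' y y'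
  proof -
    have "int y - int y' = s * (int x - int x')"
      using c[OF that(1)] c[OF that(2)] by (simp add: algebra_simps)
    then show ?thesis using assms by (simp add: abs_mult)
  qed
  \<comment> \<open>Equal images are at distance 0, hence so are their arguments.\<close>
  have "inj_on \<alpha> (dom \<alpha>)"
    using iso by (fastforce intro!: inj_onI)
  with dr iso show "\<alpha> \<in> DP n"
    by (fastforce simp: DP_def I_def)
qed

text \<open>Once \<open>a\<close> is sent to \<open>b\<close>, each \<open>x\<close> goes to
  \<open>b + (x - a)\<close> or to \<open>b - (x - a)\<close>. If some \<open>x\<close> violates the
  first form and some \<open>x'\<close> the second, both differ from \<open>a\<close> and move to
  opposite sides; then \<open>\<bar>x - x'\<bar> = \<bar>x + x' - 2 * a\<bar>\<close>, which forces
  \<open>x = a\<close> or \<open>x' = a\<close>.\<close>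

lemma DP_eq: "DP n = affine_maps 1 n \<union> affine_maps (- 1) n"
proof
  show "DP n \<subseteq> affine_maps 1 n \<union> affine_maps (- 1) n"
  proof
    fix \<alpha> assume "\<alpha> \<in> DP n"
    then have dr: "dom \<alpha> \<subseteq> X n" "ran \<alpha> \<subseteq> X n"
      and iso: "\<And>x x' y y'. \<alpha> x = Some y \<Longrightarrow> \<alpha> x' = Some y' \<Longrightarrow>
        \<bar>int x - int x'\<bar> = \<bar>int y - int y'\<bar>"
      by (force simp: DP_def I_def)+
    show "\<alpha> \<in> affine_maps 1 n \<union> affine_maps (- 1) n"
    proof (rule ccontr)
      assume contra: "\<not> ?thesis"
      \<comment> \<open>The empty map lies in both classes vacuously, so \<open>\<alpha>\<close> has
        a point.\<close>
      then obtain a b where ab: "\<alpha> a = Some b"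
        using dr by (force simp: affine_maps_def)
      \<comment> \<open>The intercepts tested, here \<open>b - a\<close> and below
        \<open>b + a\<close>, are the only ones compatible with sending \<open>a\<close> to
        \<open>b\<close>.\<close>
      have "\<not> (\<forall>x y. \<alpha> x = Some y \<longrightarrow> int y = (int b - int a) + 1 * int x)"
        using contra dr by (auto simp: affine_maps_def simp del: mult_1_left)
      then obtain x y where xy: "\<alpha> x = Some y" "int y \<noteq> int b - int a + int x"
        by auto
      have "\<not> (\<forall>x y. \<alpha> x = Some y \<longrightarrow> int y = (int b + int a) + (- 1) * int x)"
        using contra dr unfolding affine_maps_def by blast
      then obtain x' y' where xy': "\<alpha> x' = Some y'" "int y' \<noteq> int b + int a - int x'"
        by auto
      show False
        using iso[OF ab xy(1)] iso[OF ab xy'(1)] iso[OF xy(1) xy'(1)] xy(2) xy'(2)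
        by linarith
    qed
  qed
  show "affine_maps 1 n \<union> affine_maps (- 1) n \<subseteq> DP n"
    using affine_maps_subset_DP[of 1] affine_maps_subset_DP[of "- 1"] by simp
qed

section \<open>Exchanging the two kinds, and their overlap\<close>

definition reflect :: "nat \<Rightarrow> (nat \<rightharpoonup> nat) \<Rightarrow> (nat \<rightharpoonup> nat)" where
  "reflect n \<alpha> = (\<lambda>x. map_option (\<lambda>y. n + 1 - y) (\<alpha> x))"

lemma reflect_affine_maps:
  assumes "\<alpha> \<in> affine_maps s n"
  shows "reflect n \<alpha> \<in> affine_maps (- s) n"
proof -
  obtain c where dr: "dom \<alpha> \<subseteq> X n" "ran \<alpha> \<subseteq> X n"
    and c: "\<And>x y. \<alpha> x = Some y \<Longrightarrow> int y = c + s * int x"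
    using assms by (auto simp: affine_maps_def)
  \<comment> \<open>With these bounds the natural-number difference \<open>n + 1 - y\<close> is not
    truncated and stays in \<open>X n\<close>.\<close>
  have le: "1 \<le> y \<and> y \<le> n" if "\<alpha> x = Some y" for x y
    using dr that by (auto simp: X_def ran_def)
  have "dom (reflect n \<alpha>) \<subseteq> X n" "ran (reflect n \<alpha>) \<subseteq> X n"
    using dr le by (force simp: reflect_def X_def ran_def)+
  moreover have "int y = (int n + 1 - c) + (- s) * int x" if "reflect n \<alpha> x = Some y" for x y
    using that c le by (fastforce simp: reflect_def of_nat_diff)
  ultimately show ?thesis
    unfolding affine_maps_def by blast
qed

lemma reflect_reflect:
  assumes "\<alpha> \<in> affine_maps s n"
  shows "reflect n (reflect n \<alpha>) = \<alpha>"
proof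
  fix x
  have "y \<le> n" if "\<alpha> x = Some y" for y
    using assms that by (auto simp: affine_maps_def X_def ran_def)
  then show "reflect n (reflect n \<alpha>) x = \<alpha> x"
    by (cases "\<alpha> x") (auto simp: reflect_def)
qed

text \<open>\<open>reflect n\<close> sends each class into the other and is its own inverse on
  both.\<close>

lemma card_affine_maps_minus: "card (affine_maps (- s) n) = card (affine_maps s n)"
proof (rule bij_betw_same_card[of "reflect n"])
  show "bij_betw (reflect n) (affine_maps (- s) n) (affine_maps s n)"
    using reflect_affine_maps[of _ "- s"] reflect_affine_maps[of _ s]
    by (intro bij_betw_byWitness[where f' = "reflect n"]) (auto simp: reflect_reflect)
qed

text \<open>At a domain point \<open>x\<close>, \<open>c + x = d - x\<close> determines
  \<open>x\<close>, so there is at most one such point. Conversely, a single pair lies on a line of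
  every slope.\<close>

lemma translations_inter_reflections:
  "affine_maps 1 n \<inter> affine_maps (- 1) n
     = insert Map.empty ((\<lambda>(x, y). [x \<mapsto> y]) ` (X n \<times> X n))" (is "?L = ?R")
proof
  show "?L \<subseteq> ?R"
  proof
    fix \<alpha> assume "\<alpha> \<in> ?L"
    then obtain c d where dr: "dom \<alpha> \<subseteq> X n" "ran \<alpha> \<subseteq> X n"
      and c: "\<And>x y. \<alpha> x = Some y \<Longrightarrow> int y = c + 1 * int x"
      and d: "\<And>x y. \<alpha> x = Some y \<Longrightarrow> int y = d + (- 1) * int x"
      unfolding affine_maps_def by blast
    show "\<alpha> \<in> ?R"
    proof (cases "\<alpha> = Map.empty")
      case False
      then obtain a b where ab: "\<alpha> a = Some b"
        by (auto simp: fun_eq_iff)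
      have "\<alpha> = [a \<mapsto> b]"
      proof
        fix x show "\<alpha> x = [a \<mapsto> b] x"
        proof (cases "\<alpha> x")
          case (Some y)
          have "x = a"
            using c[OF ab] d[OF ab] c[OF Some] d[OF Some] by linarith
          with ab show ?thesis by simp
        qed (use ab in auto)
      qed
      moreover have "a \<in> X n" "b \<in> X n"
        using dr ab by (auto simp: ran_def)
      ultimately show ?thesis by auto
    qed simp
  qed
  have "[x \<mapsto> y] \<in> affine_maps s n" if "x \<in> X n" "y \<in> X n" for x y s
  proof -
    \<comment> \<open>The intercept is that of the line of slope \<open>s\<close> through
      \<open>(x, y)\<close>.\<close>
    have "\<forall>u v. [x \<mapsto> y] u = Some v \<longrightarrow> int v = (int y - s * int x) + s * int u"
      by auto
    moreover have "dom [x \<mapsto> y] \<subseteq> X n" "ran [x \<mapsto> y] \<subseteq> X n"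
      using that by auto
    ultimately show ?thesis unfolding affine_maps_def by blast
  qed
  moreover have "Map.empty \<in> affine_maps s n" for s
    by (simp add: affine_maps_def)
  ultimately show "?R \<subseteq> ?L"
    by auto
qed

lemma card_translations_inter_reflections:
  "card (affine_maps 1 n \<inter> affine_maps (- 1) n) = 1 + n\<^sup>2"
proof -
  have inj: "inj_on (\<lambda>(x, y). [x \<mapsto> y]) (X n \<times> X n)"
  proof (rule inj_onI, clarify)
    fix x y x' y' assume "[x \<mapsto> y] = [x' \<mapsto> (y' :: nat)]"
    from fun_cong[OF this, of x] show "x = x' \<and> y = y'"
      by (auto split: if_splits)
  qed
  have "Map.empty \<notin> (\<lambda>(x, y). [x \<mapsto> y]) ` (X n \<times> X n)"
    using map_upd_nonempty by (metis (no_types, lifting) imageE old.prod.exhaust split_conv)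
  moreover have "finite (X n)" "card (X n) = n"
    by (simp_all add: X_def)
  ultimately show ?thesis
    unfolding translations_inter_reflections
    by (simp add: card_image[OF inj] card_cartesian_product power2_eq_square)
qed

section \<open>Counting the partial translations\<close>

definition shift_domain :: "nat \<Rightarrow> int \<Rightarrow> nat set" where
  "shift_domain n c = {x \<in> X n. int x + c \<in> {1..int n}}"

text \<open>For \<open>A\<close> inside \<open>shift_domain n c\<close> the values
  \<open>int x + c\<close> are at least 1, so \<open>nat\<close> loses nothing.\<close>

definition shift_map :: "int \<times> nat set \<Rightarrow> (nat \<rightharpoonup> nat)" where
  "shift_map = (\<lambda>(c, A) x. if x \<in> A then Some (nat (int x + c)) else None)"

lemma card_shift_domain:
  assumes "c \<in> {- int n..int n}"
  shows "card (shift_domain n c) = n - nat \<bar>c\<bar>"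
proof -
  \<comment> \<open>This is \<open>{1..n - c}\<close> for \<open>c\<close> nonnegative and
    \<open>{1 - c..n}\<close> for \<open>c\<close> negative; it is empty when
    \<open>\<bar>c\<bar> = n\<close>.\<close>
  have "shift_domain n c = {nat (max 1 (1 - c))..nat (min (int n) (int n - c))}"
    by (auto simp: shift_domain_def X_def)
  then show ?thesis using assms by auto
qed

text \<open>The empty subset is removed because it gives the empty map for every shift, which would
  destroy injectivity.\<close>

abbreviation shifts :: "nat \<Rightarrow> (int \<times> nat set) set" where
  "shifts n \<equiv> (SIGMA c:{- int n..int n}. Pow (shift_domain n c) - {{}})"

text \<open>The set is recovered as the domain, and the shift from the value at any of its points,
  since \<open>nat\<close> is injective on positive integers.\<close>

lemma inj_on_shift_map: "inj_on shift_map (shifts n)"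
proof (rule inj_onI, elim SigmaE, hypsubst)
  fix c A d B
  assume A: "A \<in> Pow (shift_domain n c) - {{}}" and B: "B \<in> Pow (shift_domain n d) - {{}}"
    and eq: "shift_map (c, A) = shift_map (d, B)"
  have "dom (shift_map (c, A)) = A" "dom (shift_map (d, B)) = B"
    by (auto simp: shift_map_def split: if_splits)
  with eq have AB: "A = B" by simp
  obtain x where x: "x \<in> A" using A by auto
  then have "int x + c \<ge> 1" "int x + d \<ge> 1"
    using A B AB by (auto simp: shift_domain_def)
  moreover have "nat (int x + c) = nat (int x + d)"
    using fun_cong[OF eq, of x] x AB by (simp add: shift_map_def)
  ultimately show "(c, A) = (d, B)" using AB by simp
qed

lemma shift_map_image: "affine_maps 1 n = insert Map.empty (shift_map ` shifts n)"
proof (intro equalityI subsetI)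
  fix \<alpha> assume "\<alpha> \<in> affine_maps 1 n"
  then obtain c where dr: "dom \<alpha> \<subseteq> X n" "ran \<alpha> \<subseteq> X n"
    and c: "\<And>x y. \<alpha> x = Some y \<Longrightarrow> int y = c + int x"
    by (auto simp: affine_maps_def)
  show "\<alpha> \<in> insert Map.empty (shift_map ` shifts n)"
  proof (cases "\<alpha> = Map.empty")
    case False
    have bounds: "1 \<le> x \<and> x \<le> n \<and> 1 \<le> y \<and> y \<le> n" if "\<alpha> x = Some y" for x y
      using dr that by (auto simp: X_def ran_def)
    have "dom \<alpha> \<subseteq> shift_domain n c"
      using bounds c by (fastforce simp: shift_domain_def X_def)
    moreover obtain a b where "\<alpha> a = Some b"
      using False by (auto simp: fun_eq_iff)
    then have "c \<in> {- int n..int n}"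
      using bounds[of a b] c[of a b] by auto
    moreover have "\<alpha> = shift_map (c, dom \<alpha>)"
    proof
      fix x show "\<alpha> x = shift_map (c, dom \<alpha>) x"
      proof (cases "\<alpha> x")
        case (Some y)
        then have "nat (int x + c) = y" using c[of x y] by simp
        with Some show ?thesis by (simp add: shift_map_def domI)
      qed (simp add: shift_map_def domIff)
    qed
    ultimately show ?thesis using False by blast
  qed simp
next
  fix \<alpha> assume "\<alpha> \<in> insert Map.empty (shift_map ` shifts n)"
  then consider "\<alpha> = Map.empty" | c A where "\<alpha> = shift_map (c, A)" "A \<subseteq> shift_domain n c"
    by auto
  then show "\<alpha> \<in> affine_maps 1 n"
  proof cases
    case 2
    then have "\<forall>x y. \<alpha> x = Some y \<longrightarrow> int y = c + 1 * int x"
      by (auto simp: shift_map_def shift_domain_def)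
    moreover have "dom \<alpha> \<subseteq> X n" "ran \<alpha> \<subseteq> X n"
      using 2 by (fastforce simp: shift_map_def shift_domain_def X_def ran_def split: if_splits)+
    ultimately show ?thesis unfolding affine_maps_def by blast
  qed (simp add: affine_maps_def)
qed

text \<open>The indices \<open>c\<close> and \<open>- c\<close> contribute equally, and doubling
  counts the index 0 once too often.\<close>

lemma sum_symmetric_int_interval:
  fixes f :: "nat \<Rightarrow> 'a :: comm_ring_1"
  shows "(\<Sum>c\<in>{- int n..int n}. f (nat \<bar>c\<bar>)) = 2 * (\<Sum>i\<le>n. f i) - f 0"
proof (induction n)
  case (Suc n)
  have "{- int (Suc n)..int (Suc n)}
      = insert (int (Suc n)) (insert (- int (Suc n)) {- int n..int n})"
    by auto
  then have "(\<Sum>c\<in>{- int (Suc n)..int (Suc n)}. f (nat \<bar>c\<bar>))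
      = f (Suc n) + (f (Suc n) + (\<Sum>c\<in>{- int n..int n}. f (nat \<bar>c\<bar>)))"
    by (simp add: nat_add_distrib)
  with Suc show ?case by (simp add: algebra_simps)
qed simp

lemma card_translations: "int (card (affine_maps 1 n)) = 3 * 2 ^ n - 2 * int n - 2"
proof -
  have fin: "finite (shift_domain n c)" for c
    by (simp add: shift_domain_def X_def)
  have "card (Pow (shift_domain n c) - {{}}) = 2 ^ (n - nat \<bar>c\<bar>) - 1"
    if "c \<in> {- int n..int n}" for c
    using that fin by (subst card_Diff_singleton) (auto simp: card_Pow card_shift_domain)
  then have "card (shifts n) = (\<Sum>c\<in>{- int n..int n}. 2 ^ (n - nat \<bar>c\<bar>) - 1)"
    using fin by (subst card_SigmaI) auto
  \<comment> \<open>Powers of 2 are at least 1, so subtracting 1 in \<open>nat\<close> agrees with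
    \<open>int\<close>.\<close>
  also have "int \<dots> = (\<Sum>c\<in>{- int n..int n}. (2 ^ (n - nat \<bar>c\<bar>) - 1 :: int))"
    by (simp add: of_nat_diff)
  also have "\<dots> = 2 * (\<Sum>i\<le>n. 2 ^ (n - i) - 1) - (2 ^ n - 1)"
    using sum_symmetric_int_interval[of "\<lambda>i. 2 ^ (n - i) - 1" n] by simp
  also have "(\<Sum>i\<le>n. 2 ^ (n - i) - 1 :: int) = (\<Sum>i\<le>n. 2 ^ (n - i)) - int (Suc n)"
    by (simp add: sum_subtractf)
  \<comment> \<open>Reversing the order of summation gives a geometric sum.\<close>
  also have "(\<Sum>i\<le>n. 2 ^ (n - i) :: int) = (\<Sum>i\<le>n. 2 ^ i)"
    using sum.nat_diff_reindex[of "\<lambda>i. 2 ^ i :: int" "Suc n"] by (simp add: lessThan_Suc_atMost)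
  also have "\<dots> = 2 ^ Suc n - 1"
    by (induction n) auto
  finally have "int (card (shifts n)) = 3 * 2 ^ n - 2 * int n - 3"
    by simp
  moreover have "finite (shifts n)"
    using fin by auto
  \<comment> \<open>The empty map is therefore one further translation, which turns the constant -3
    into -2.\<close>
  moreover have "Map.empty \<notin> shift_map ` shifts n"
    by (auto simp: shift_map_def fun_eq_iff split: if_splits)
  ultimately show ?thesis
    by (simp add: shift_map_image card_image[OF inj_on_shift_map])
qed

theorem theorem3p16:
  fixes n :: nat
  shows "int (card (DP n)) = 3 * 2 ^ (n + 1) - (int n + 2)\<^sup>2 - 1"
proof -
  \<comment> \<open>Inclusion-exclusion, written additively to avoid subtraction in
    \<open>nat\<close>.\<close>
  have "card (DP n) + (1 + n\<^sup>2) = 2 * card (affine_maps 1 n)"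
    using card_Un_Int[OF finite_affine_maps finite_affine_maps, of 1 n "- 1" n]
    by (simp add: DP_eq card_translations_inter_reflections card_affine_maps_minus)
  then have "int (card (DP n)) + (1 + (int n)\<^sup>2) = 2 * int (card (affine_maps 1 n))"
    by (metis of_nat_1 of_nat_add of_nat_mult of_nat_numeral of_nat_power)
  \<comment> \<open>The terms \<open>- 4 * n - 4\<close> from the doubled count join
    \<open>- n\<^sup>2\<close> to form \<open>- (n + 2)\<^sup>2\<close>.\<close>
  then show ?thesis
    by (simp add: card_translations power2_eq_square algebra_simps)
qed

end
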